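(* Let $G$ be a polyhedral group and consider an irreducible complex representation of $G$ (the $p$th irreducible representation), of dimension $d_p$. Real basis functions of $G$ for this irreducible representation exist if and only if this irreducible representation is potentially real.
   Context: A polyhedral group $G$ is the tetrahedral, octahedral or icosahedral rotation group (the rotational symmetry group of a platonic solid centered at the origin of $\mathbb{R}^3$); $R_g\in\mathbb{R}^{3\times3}$ denotes the rotation matrix of $g\in G$, with $R_{gh}=R_gR_h$. Irreducible representations are given by unitary matrices. Potentially real: the irreducible representation given by unitary matrices $\Gamma_c^p(g)\in\mathbb{C}^{d_p\times d_p}$, $g\in G$, is potentially real if there is a unitary matrix $S^p\in\mathbb{C}^{d_p\times d_p}$ such that $(S^p)^H\Gamma_c^p(g)S^p\in\mathbb{R}^{d_p\times d_p}$ for all $g\in G$, where $(\cdot)^H$ is the conjugate transpose. Basis function: a basis function for the $p$th irreducible representation is a $d_p$-dimensional vector function $I_{p;\zeta}=(I_{p;\zeta}[1],\dots,I_{p;\zeta}[d_p])^T$ on the unit sphere $S^2\subset\mathbb{R}^3$ with square-integrable components, orthonormal with respect to $(f,h)=\int_{S^2}\overline{f}\,h$ (surface measure), such that $$I_{p;\zeta}(R_g^{-1}\mathbf{x})=(\Gamma^p(g))^T I_{p;\zeta}(\mathbf{x})\quad\text{for all } g\in G,$$ where $\Gamma^p(g)\in\mathbb{C}^{d_p\times d_p}$, $g\in G$, are some unitary matrices realizing the $p$th irreducible representation (i.e. some unitary matrix representation equivalent to $\Gamma_c^p$). A basis function is real if it takes values in $\mathbb{R}^{d_p}$. "Real basis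 functions exist" for the $p$th irreducible representation means that there is at least one real basis function for it. *)

theory Defs
  imports "HOL-Analysis.Analysis" "HOL-Algebra.Group"
begin

definition phi :: real where
  "phi = (1 + sqrt 5) / 2"

definition tetrahedron_vertices :: "(real^3) set" where
  "tetrahedron_vertices =
     {vector [1, 1, 1], vector [1, -1, -1], vector [-1, 1, -1], vector [-1, -1, 1]}"

definition cube_vertices :: "(real^3) set" where
  "cube_vertices = {vector [a, b, c] | a b c. a \<in> {-1, 1} \<and> b \<in> {-1, 1} \<and> c \<in> {-1, 1}}"

definition octahedron_vertices :: "(real^3) set" where
  "octahedron_vertices =
     (\<Union>s\<in>{-1, 1}. {vector [s, 0, 0], vector [0, s, 0], vector [0, 0, s]})"

definition icosahedron_vertices :: "(real^3) set" where
  "icosahedron_vertices =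
     (\<Union>s\<in>{-1, 1}. \<Union>t\<in>{-1, 1}.
        {vector [0, s, t * phi], vector [s, t * phi, 0], vector [t * phi, 0, s]})"

definition dodecahedron_vertices :: "(real^3) set" where
  "dodecahedron_vertices = cube_vertices \<union>
     (\<Union>s\<in>{-1, 1}. \<Union>t\<in>{-1, 1}.
        {vector [0, s * phi, t / phi], vector [s * phi, t / phi, 0], vector [t / phi, 0, s * phi]})"

text \<open>The Platonic solids centred at the origin, of arbitrary size and orientation.\<close>

definition platonic_solid :: "(real^3) set \<Rightarrow> bool" where
  "platonic_solid P \<longleftrightarrow>
     (\<exists>V c Q. V \<in> {tetrahedron_vertices, cube_vertices, octahedron_vertices,
                  icosahedron_vertices, dodecahedron_vertices} \<and>
        0 < c \<and> orthogonal_matrix Q \<and> P = (\<lambda>x. c *\<^sub>R (Q *v x)) ` (convex hull V))"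

definition rotation_group :: "(real^3) set \<Rightarrow> (real^3^3) monoid" where
  "rotation_group P =
     \<lparr>carrier = {A. rotation_matrix A \<and> (*v) A ` P = P}, mult = (**), one = mat 1\<rparr>"

lemma group_rotation_group: "group (rotation_group P)"
proof (rule groupI)
  fix A assume "A \<in> carrier (rotation_group P)"
  then have A: "orthogonal_matrix A" "det A = 1" "(*v) A ` P = P"
    by (auto simp: rotation_group_def rotation_matrix_def)
  then have inv: "transpose A ** A = mat 1"
    by (simp add: orthogonal_matrix)
  have "(*v) (transpose A) ` ((*v) A ` P) = P"
    by (simp add: image_image matrix_vector_mul_assoc inv del: transpose_matrix_vector)
  then have "(*v) (transpose A) ` P = P"
    using A by simp
  with A have "transpose A \<in> carrier (rotation_group P)"
    by (simp add: rotation_group_def rotation_matrix_def)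
  with inv show "\<exists>B\<in>carrier (rotation_group P). B \<otimes>\<^bsub>rotation_group P\<^esub> A = \<one>\<^bsub>rotation_group P\<^esub>"
    by (intro bexI[of _ "transpose A"]) (simp_all add: rotation_group_def)
next
  fix A B assume "A \<in> carrier (rotation_group P)" "B \<in> carrier (rotation_group P)"
  then have A: "orthogonal_matrix A" "det A = 1" "(*v) A ` P = P"
    and B: "orthogonal_matrix B" "det B = 1" "(*v) B ` P = P"
    by (auto simp: rotation_group_def rotation_matrix_def)
  have "(*v) (A ** B) ` P = (*v) A ` ((*v) B ` P)"
    by (simp add: image_image matrix_vector_mul_assoc)
  with A B show "A \<otimes>\<^bsub>rotation_group P\<^esub> B \<in> carrier (rotation_group P)"
    by (simp add: rotation_group_def rotation_matrix_def orthogonal_matrix_mul det_mul)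
qed (auto simp: rotation_group_def rotation_matrix_def orthogonal_matrix_id matrix_mul_assoc)

text \<open>\<open>R\<close> assigns to each \<open>g\<close> in the abstract group \<open>G\<close> its rotation matrix.\<close>

definition polyhedral_group :: "('g, 'b) monoid_scheme \<Rightarrow> ('g \<Rightarrow> real^3^3) \<Rightarrow> bool" where
  "polyhedral_group G R \<longleftrightarrow>
     group G \<and> (\<exists>P. platonic_solid P \<and> R \<in> iso G (rotation_group P))"

definition conj_transpose :: "complex^'n^'m \<Rightarrow> complex^'m^'n" where
  "conj_transpose A = transpose (map_matrix cnj A)"

definition unitary_matrix :: "complex^'n^'n \<Rightarrow> bool" where
  "unitary_matrix U \<longleftrightarrow> conj_transpose U ** U = mat 1 \<and> U ** conj_transpose U = mat 1"

definition real_matrix :: "complex^'n^'m \<Rightarrow> bool" where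
  "real_matrix A \<longleftrightarrow> (\<forall>i j. A $ i $ j \<in> \<real>)"

definition unitary_group :: "(complex^'n^'n) monoid" where
  "unitary_group = \<lparr>carrier = {U. unitary_matrix U}, mult = (**), one = mat 1\<rparr>"

definition unitary_rep :: "('g, 'b) monoid_scheme \<Rightarrow> ('g \<Rightarrow> complex^'d^'d) \<Rightarrow> bool" where
  "unitary_rep G \<Gamma> \<longleftrightarrow> \<Gamma> \<in> hom G unitary_group"

text \<open>
  The subspaces here are the complex ones (\<open>vec.subspace\<close>), not those over the reals
  (\<open>subspace\<close>). The space itself is nonzero, since index types are nonempty.
\<close>

definition irreducible_rep :: "('g, 'b) monoid_scheme \<Rightarrow> ('g \<Rightarrow> complex^'d^'d) \<Rightarrow> bool" where
  "irreducible_rep G \<Gamma> \<longleftrightarrow>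
     (\<forall>W. vec.subspace W \<and> (\<forall>g\<in>carrier G. \<forall>v\<in>W. \<Gamma> g *v v \<in> W) \<longrightarrow> W = {0} \<or> W = UNIV)"

definition equivalent_reps ::
    "('g, 'b) monoid_scheme \<Rightarrow> ('g \<Rightarrow> complex^'d^'d) \<Rightarrow> ('g \<Rightarrow> complex^'d^'d) \<Rightarrow> bool" where
  "equivalent_reps G \<Gamma> \<Gamma>' \<longleftrightarrow>
     (\<exists>T. invertible T \<and> (\<forall>g\<in>carrier G. \<Gamma>' g = matrix_inv T ** \<Gamma> g ** T))"

definition potentially_real :: "('g, 'b) monoid_scheme \<Rightarrow> ('g \<Rightarrow> complex^'d^'d) \<Rightarrow> bool" where
  "potentially_real G \<Gamma> \<longleftrightarrow>
     (\<exists>S. unitary_matrix S \<and> (\<forall>g\<in>carrier G. real_matrix (conj_transpose S ** \<Gamma> g ** S)))"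

text \<open>
  The area of a Borel set \<open>A\<close> of the unit sphere in three dimensions is three times the volume
  of the cone over \<open>A\<close>, i.e. of the set of points \<open>x \<noteq> 0\<close> in the unit ball with
  \<open>x / norm x \<in> A\<close>.
\<close>

definition sphere_measure :: "(real^3) measure" where
  "sphere_measure =
     distr (density (restrict_space lborel (cball 0 1 - {0})) (\<lambda>_. 3))
           (restrict_space borel (sphere 0 1)) (\<lambda>x. x /\<^sub>R norm x)"

lemma measurable_sphere_projection:
  "(\<lambda>x::real^3. x /\<^sub>R norm x)
     \<in> density (restrict_space lborel (cball 0 1 - {0})) (\<lambda>_. 3)
         \<rightarrow>\<^sub>M restrict_space borel (sphere 0 1)"
proof -
  have "(\<lambda>x::real^3. x /\<^sub>R norm x) \<in> borel \<rightarrow>\<^sub>M borel"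
    by measurable
  then have "(\<lambda>x::real^3. x /\<^sub>R norm x)
      \<in> restrict_space lborel (cball 0 1 - {0}) \<rightarrow>\<^sub>M restrict_space borel (sphere 0 1)"
    by (intro measurable_restrict_space2 measurable_restrict_space1)
       (auto simp: space_restrict_space)
  then show ?thesis
    by simp
qed

lemma emeasure_sphere_measure:
  assumes "A \<in> sets borel" "A \<subseteq> sphere 0 1"
  shows "emeasure sphere_measure A = 3 * emeasure lborel {x \<in> cball 0 1 - {0}. x /\<^sub>R norm x \<in> A}"
proof -
  let ?D = "restrict_space lborel (cball 0 1 - {0}) :: (real^3) measure"
  let ?C = "{x \<in> cball 0 1 - {0}. x /\<^sub>R norm x \<in> A}"
  have A: "A \<in> sets (restrict_space borel (sphere 0 1))"
    using assms by (simp add: sets_restrict_space_iff)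
  have C: "(\<lambda>x. x /\<^sub>R norm x) -` A \<inter> space ?D = ?C"
    by (auto simp: space_restrict_space)
  have C': "?C \<in> sets ?D"
    using measurable_sets[OF measurable_sphere_projection A] C by simp
  have "emeasure sphere_measure A = emeasure (density ?D (\<lambda>_. 3)) ?C"
    unfolding sphere_measure_def using measurable_sphere_projection A C
    by (simp add: emeasure_distr)
  also have "\<dots> = 3 * emeasure ?D ?C"
    using C' by (simp add: emeasure_density_const)
  also have "emeasure ?D ?C = emeasure lborel ?C"
    by (rule emeasure_restrict_space) auto
  finally show ?thesis .
qed

lemma emeasure_sphere_measure_sphere:
  "emeasure sphere_measure (sphere 0 1) = ennreal (4 * pi)"
proof -
  have "{x::real^3. x \<in> cball 0 1 - {0} \<and> x /\<^sub>R norm x \<in> sphere 0 1} = cball 0 1 - {0}"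
    by auto
  then have "emeasure sphere_measure (sphere 0 1) = 3 * emeasure lborel (cball 0 1 - {0::real^3})"
    by (simp add: emeasure_sphere_measure)
  also have "emeasure lborel (cball 0 1 - {0::real^3}) = emeasure lborel (cball 0 1 :: (real^3) set)"
    by (rule emeasure_Diff_null_set) auto
  also have "3 * \<dots> = ennreal (4 * pi)"
    by (simp add: emeasure_cball unit_ball_vol_3 flip: ennreal_numeral ennreal_mult')
  finally show ?thesis .
qed

definition square_integrable :: "'a measure \<Rightarrow> ('a \<Rightarrow> complex) \<Rightarrow> bool" where
  "square_integrable M f \<longleftrightarrow>
     f \<in> borel_measurable M \<and> integrable M (\<lambda>x. (cmod (f x))\<^sup>2)"

definition L2_inner :: "'a measure \<Rightarrow> ('a \<Rightarrow> complex) \<Rightarrow> ('a \<Rightarrow> complex) \<Rightarrow> complex" where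
  "L2_inner M f h = (LINT x|M. cnj (f x) * h x)"

text \<open>Only the values of \<open>I\<close> on the unit sphere are relevant.\<close>

definition basis_function ::
    "('g, 'b) monoid_scheme \<Rightarrow> ('g \<Rightarrow> real^3^3) \<Rightarrow> ('g \<Rightarrow> complex^'d^'d) \<Rightarrow>
     (real^3 \<Rightarrow> complex^'d) \<Rightarrow> bool" where
  "basis_function G R \<Gamma>\<^sub>c I \<longleftrightarrow>
     (\<forall>i. square_integrable sphere_measure (\<lambda>x. I x $ i)) \<and>
     (\<forall>i j. L2_inner sphere_measure (\<lambda>x. I x $ i) (\<lambda>x. I x $ j) = (if i = j then 1 else 0)) \<and>
     (\<exists>\<Gamma>. unitary_rep G \<Gamma> \<and> equivalent_reps G \<Gamma>\<^sub>c \<Gamma> \<and>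
        (\<forall>g\<in>carrier G. \<forall>x\<in>sphere 0 1.
           I (matrix_inv (R g) *v x) = transpose (\<Gamma> g) *v I x))"

definition real_basis_function ::
    "('g, 'b) monoid_scheme \<Rightarrow> ('g \<Rightarrow> real^3^3) \<Rightarrow> ('g \<Rightarrow> complex^'d^'d) \<Rightarrow>
     (real^3 \<Rightarrow> complex^'d) \<Rightarrow> bool" where
  "real_basis_function G R \<Gamma>\<^sub>c I \<longleftrightarrow>
     basis_function G R \<Gamma>\<^sub>c I \<and> (\<forall>x\<in>sphere 0 1. \<forall>i. I x $ i \<in> \<real>)"

end

theory Submission
  imports Defs
begin

text \<open>
  Suppose that \<open>I\<close> is a real basis function, transforming under \<open>\<Gamma>\<close>. Comparing the
  transformation law with its complex conjugate and using that the components of \<open>I\<close> are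
  linearly independent shows that \<open>\<Gamma>\<close> is real (\<open>real_basis_function_imp_real_rep\<close>). It is
  equivalent to \<open>\<Gamma>\<^sub>c\<close>, but by an invertible matrix only; by Schur's lemma that matrix is a
  multiple of a unitary one (\<open>unitarily_equivalent\<close>), which is what potential reality asks
  for.

  Conversely, conjugating \<open>\<Gamma>\<^sub>c\<close> by the given unitary matrix yields a real irreducible
  representation \<open>\<Gamma>\<close>, and it has to be found inside the functions on the sphere. The group
  is finite, since rotations of a platonic solid permute its vertices, which span the space,
  so some point of the sphere is moved by every nontrivial rotation, and its orbit can be
  surrounded by disjoint caps of equal area, one for each group element
  (\<open>polyhedral_group_disjoint_caps\<close>). Functions that are constant on each cap are then
  functions on \<open>G\<close>, so the regular representation, and with it every irreducible one, occurs
  on the sphere. Explicitly, the step function whose value on the cap of \<open>g\<close> is a fixed row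
  of \<open>\<Gamma> g\<close> transforms as required, is real, and has orthogonal components of equal norm by
  Schur orthogonality (\<open>schur_orthogonality\<close>).

  Both uses of Schur's lemma concern a Hermitian matrix (\<open>schur_hermitian\<close>), which has an
  eigenvector because its quadratic form attains a maximum on the unit sphere.
\<close>

section \<open>Complex matrices and unitary representations\<close>

lemma conj_transpose_nth [simp]: "conj_transpose A $ i $ j = cnj (A $ j $ i)"
  by (simp add: conj_transpose_def transpose_def map_matrix_def)

lemma conj_transpose_conj_transpose [simp]: "conj_transpose (conj_transpose A) = A"
  by (simp add: vec_eq_iff)

lemma conj_transpose_mult: "conj_transpose (A ** B) = conj_transpose B ** conj_transpose A"
  by (simp add: vec_eq_iff matrix_matrix_mult_def cnj_sum mult.commute)

lemma conj_transpose_scaleR: "conj_transpose (c *\<^sub>R A) = c *\<^sub>R conj_transpose A"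
  by (simp add: vec_eq_iff)

lemma conj_transpose_sum: "conj_transpose (sum f A) = (\<Sum>x\<in>A. conj_transpose (f x))"
  by (simp add: vec_eq_iff cnj_sum)

lemma inner_adjoint:
  fixes A :: "complex^'n^'m"
  shows "inner (A *v x) y = inner x (conj_transpose A *v y)"
proof -
  have c: "inner a b = Re (cnj a * b)" for a b :: complex
    by (simp add: inner_complex_def)
  have "inner (A *v x) y = Re (\<Sum>i\<in>UNIV. \<Sum>j\<in>UNIV. cnj (A $ i $ j) * cnj (x $ j) * y $ i)"
    by (simp add: inner_vec_def c matrix_vector_mult_def cnj_sum sum_distrib_right)
  also have "\<dots> = Re (\<Sum>j\<in>UNIV. \<Sum>i\<in>UNIV. cnj (A $ i $ j) * cnj (x $ j) * y $ i)"
    by (subst sum.swap) simp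
  also have "\<dots> = inner x (conj_transpose A *v y)"
    by (simp add: inner_vec_def c matrix_vector_mult_def cnj_sum sum_distrib_left algebra_simps)
  finally show ?thesis .
qed

lemma mult_sum_matrix:
  fixes A :: "'a::semiring_1^'n^'m"
  shows "A ** sum f I = (\<Sum>i\<in>I. A ** f i)"
  by (simp add: vec_eq_iff matrix_matrix_mult_def sum_distrib_left sum.swap[of _ _ I])

lemma sum_matrix_mult:
  fixes A :: "'a::semiring_1^'n^'m"
  shows "sum f I ** A = (\<Sum>i\<in>I. f i ** A)"
  by (simp add: vec_eq_iff matrix_matrix_mult_def sum_distrib_right sum.swap[of _ _ I])

lemma linear_matrix_vector: "linear ((*v) (A :: complex^'n^'m))"
  by (rule linearI)
     (simp_all add: vec.add, simp add: vec_eq_iff matrix_vector_mult_def scaleR_sum_right)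

text \<open>
  A maximiser \<open>v\<close> of the quadratic form of \<open>M\<close> on the unit sphere is an eigenvector: with
  \<open>c\<close> the maximum, \<open>N = c - M\<close> is positive semidefinite and its form vanishes at \<open>v\<close>, so its
  value at \<open>v - e w\<close>, where \<open>w = N v\<close>, is a nonnegative number whose linear term in \<open>e\<close> is
  \<open>- 2 \<bar>w\<bar>\<^sup>2 e\<close>; this forces \<open>w = 0\<close>. The inner product is the real one, the real part of
  the Hermitian product.
\<close>

lemma hermitian_eigenvector:
  fixes M :: "complex^'n^'n"
  assumes M: "conj_transpose M = M"
  obtains c :: real and v where "v \<noteq> 0" "M *v v = c *\<^sub>R v"
proof -
  have adj: "inner (M *v x) y = inner x (M *v y)" for x y
    using inner_adjoint[of M x y] M by simp
  have lin: "linear ((*v) M)"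
    by (rule linear_matrix_vector)
  have "continuous_on (sphere 0 1) (\<lambda>x. inner x (M *v x))"
    by (intro continuous_intros linear_continuous_on linear_linear[THEN iffD2] lin)
  moreover have "sphere 0 1 \<noteq> ({} :: (complex^'n) set)"
    by simp
  ultimately obtain v where v: "norm v = 1"
    and max: "\<And>x. norm x = 1 \<Longrightarrow> inner x (M *v x) \<le> inner v (M *v v)"
    using continuous_attains_sup[of "sphere 0 1" "\<lambda>x. inner x (M *v x)"] by auto
  define c where "c = inner v (M *v v)"
  have le: "inner x (M *v x) \<le> c * inner x x" for x
  proof (cases "x = 0")
    case False
    have "inner (x /\<^sub>R norm x) (M *v (x /\<^sub>R norm x)) \<le> c"
      unfolding c_def using False by (intro max) simp
    then show ?thesis
      using False by (simp add: linear_scale[OF lin] field_simps power2_norm_eq_inner[symmetric] power2_eq_square)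
  qed simp
  define N where "N x = c *\<^sub>R x - M *v x" for x
  have N0: "inner v (N v) = 0"
    using v by (simp add: N_def c_def inner_diff_right power2_norm_eq_inner[symmetric])
  define w where "w = N v"
  have "2 * (norm w)\<^sup>2 \<le> e * inner w (N w)" if "e > 0" for e
  proof -
    have "0 \<le> inner (v - e *\<^sub>R w) (N (v - e *\<^sub>R w))"
      using le[of "v - e *\<^sub>R w"] by (simp add: N_def inner_diff_right)
    also have "N (v - e *\<^sub>R w) = N v - e *\<^sub>R N w"
      by (simp add: N_def linear_diff[OF lin] linear_scale[OF lin] algebra_simps)
    also have "inner (v - e *\<^sub>R w) (N v - e *\<^sub>R N w) =
        e\<^sup>2 * inner w (N w) - e * inner w (N v) - e * inner v (N w)"
      using N0 by (simp add: inner_diff_left inner_diff_right power2_eq_square algebra_simps)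
    also have "inner v (N w) = inner w (N v)"
      using adj[of w v] by (simp add: N_def inner_diff_right inner_commute[of v])
    also have "inner w (N v) = (norm w)\<^sup>2"
      by (simp add: w_def power2_norm_eq_inner)
    finally have "e * (2 * (norm w)\<^sup>2) \<le> e * (e * inner w (N w))"
      by (simp add: power2_eq_square)
    with that show ?thesis by simp
  qed
  then have "\<forall>\<^sub>F e in at_right 0. 2 * (norm w)\<^sup>2 \<le> e * inner w (N w)"
    by (simp add: eventually_at_filter)
  moreover have "((\<lambda>e. e * inner w (N w)) \<longlongrightarrow> 0 * inner w (N w)) (at_right 0)"
    by (intro tendsto_intros)
  ultimately have "2 * (norm w)\<^sup>2 \<le> 0 * inner w (N w)"
    by (intro tendsto_lowerbound) auto
  then have "w = 0" by simp
  then have "M *v v = c *\<^sub>R v" by (simp add: w_def N_def)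
  moreover have "v \<noteq> 0" using v by auto
  ultimately show thesis using that by blast
qed

text \<open>
  Schur's lemma for Hermitian matrices. It is the only way in which irreducibility enters
  the proof, once for \<open>T T\<^sup>H\<close> with an intertwiner \<open>T\<close>, once for a sum over the group. An
  eigenspace of \<open>M\<close> is invariant, hence everything.
\<close>

lemma schur_hermitian:
  fixes M :: "complex^'n^'n"
  assumes irr: "irreducible_rep G \<Gamma>" and M: "conj_transpose M = M"
    and comm: "\<And>g. g \<in> carrier G \<Longrightarrow> M ** \<Gamma> g = \<Gamma> g ** M"
  obtains c :: real where "M = c *\<^sub>R mat 1"
proof -
  obtain c v where v: "v \<noteq> 0" "M *v v = c *\<^sub>R v"
    using hermitian_eigenvector[OF M] .
  define W where "W = {v. M *v v = c *\<^sub>R v}"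
  have "vec.subspace W"
    unfolding vec.subspace_def W_def
    by (auto simp: vec.add vec.scale scaleR_right_distrib vec_eq_iff)
  moreover have "\<Gamma> g *v u \<in> W" if "g \<in> carrier G" "u \<in> W" for g u
  proof -
    have "M *v (\<Gamma> g *v u) = \<Gamma> g *v (M *v u)"
      using comm[OF that(1)] by (simp add: matrix_vector_mul_assoc)
    also have "\<dots> = c *\<^sub>R (\<Gamma> g *v u)"
      using that(2) by (simp add: W_def linear_scale[OF linear_matrix_vector])
    finally show ?thesis by (simp add: W_def)
  qed
  ultimately have "W = {0} \<or> W = UNIV"
    using irr by (auto simp: irreducible_rep_def)
  moreover have "v \<in> W" using v by (simp add: W_def)
  ultimately have "W = UNIV" using v by auto
  moreover have "(c *\<^sub>R mat 1) *v u = c *\<^sub>R u" for u :: "complex^'n"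
    by (simp add: vec_eq_iff matrix_vector_mult_def mat_def if_distrib[of "\<lambda>x. x * _"] cong: if_cong)
       (simp add: scaleR_sum_right[symmetric] if_distrib[of "scaleR _"] if_distrib[of "\<lambda>x. x * _"] cong: if_cong)
  ultimately have "M = c *\<^sub>R mat 1"
    unfolding matrix_eq W_def by auto
  then show thesis using that by blast
qed

lemma unitary_rep_D:
  assumes "unitary_rep G \<Gamma>"
  shows "g \<in> carrier G \<Longrightarrow> conj_transpose (\<Gamma> g) ** \<Gamma> g = mat 1"
    and "g \<in> carrier G \<Longrightarrow> \<Gamma> g ** conj_transpose (\<Gamma> g) = mat 1"
    and "g \<in> carrier G \<Longrightarrow> h \<in> carrier G \<Longrightarrow> \<Gamma> (g \<otimes>\<^bsub>G\<^esub> h) = \<Gamma> g ** \<Gamma> h"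
  using assms by (auto simp: unitary_rep_def hom_def unitary_group_def unitary_matrix_def)

lemma matrix_inv_eqI:
  fixes A :: "'a::field^'n^'n"
  assumes "B ** A = mat 1"
  shows "matrix_inv A = B"
proof -
  have "A ** B = mat 1" using assms matrix_left_right_inverse by blast
  then have "A ** matrix_inv A = mat 1 \<and> matrix_inv A ** A = mat 1"
    using assms unfolding matrix_inv_def by (intro someI[where P = "\<lambda>B. A ** B = mat 1 \<and> B ** A = mat 1"]) auto
  then have "matrix_inv A = (B ** A) ** matrix_inv A" "A ** matrix_inv A = mat 1"
    using assms by simp_all
  then show ?thesis by (metis matrix_mul_assoc matrix_mul_rid)
qed

text \<open>
  Equivalence passes to unitary equivalence: if \<open>T\<close> intertwines two unitary representations,
  then so does \<open>T\<^sup>H\<close> in the other direction, so \<open>T T\<^sup>H\<close> commutes with an irreducible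
  representation, is a positive multiple \<open>c\<close> of the identity, and \<open>T\<close> becomes unitary on
  division by \<open>sqrt c\<close>.
\<close>

lemma unitarily_equivalent:
  fixes \<Gamma> \<Gamma>' :: "'g \<Rightarrow> complex^'n^'n"
  assumes "unitary_rep G \<Gamma>" "irreducible_rep G \<Gamma>" "unitary_rep G \<Gamma>'" "equivalent_reps G \<Gamma> \<Gamma>'"
  obtains S where "unitary_matrix S" "\<And>g. g \<in> carrier G \<Longrightarrow> \<Gamma>' g = conj_transpose S ** \<Gamma> g ** S"
proof -
  obtain T where T: "invertible T" "\<And>g. g \<in> carrier G \<Longrightarrow> \<Gamma>' g = matrix_inv T ** \<Gamma> g ** T"
    using assms by (auto simp: equivalent_reps_def)
  obtain T' where T': "T' ** T = mat 1" "T ** T' = mat 1"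
    using T by (auto simp: invertible_def)
  have inv: "matrix_inv T = T'"
    using T'(1) by (rule matrix_inv_eqI)
  have int: "T ** \<Gamma>' g = \<Gamma> g ** T" if "g \<in> carrier G" for g
    using T(2)[OF that] by (simp add: inv matrix_mul_assoc T')
  have intH: "\<Gamma>' g ** conj_transpose T = conj_transpose T ** \<Gamma> g" if "g \<in> carrier G" for g
  proof -
    have "conj_transpose T ** \<Gamma> g = \<Gamma>' g ** (conj_transpose (\<Gamma>' g) ** conj_transpose T) ** \<Gamma> g"
      by (simp add: matrix_mul_assoc unitary_rep_D[OF assms(3) that])
    also have "\<dots> = \<Gamma>' g ** conj_transpose T ** (conj_transpose (\<Gamma> g) ** \<Gamma> g)"
      by (simp only: conj_transpose_mult[symmetric] int[OF that]) (simp only: conj_transpose_mult matrix_mul_assoc)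
    also have "\<dots> = \<Gamma>' g ** conj_transpose T"
      by (simp add: unitary_rep_D[OF assms(1) that])
    finally show ?thesis ..
  qed
  obtain c :: real where c: "T ** conj_transpose T = c *\<^sub>R mat 1"
  proof (rule schur_hermitian[OF assms(2)])
    fix g assume g: "g \<in> carrier G"
    show "T ** conj_transpose T ** \<Gamma> g = \<Gamma> g ** (T ** conj_transpose T)"
      by (metis g int intH matrix_mul_assoc)
  qed (auto simp: conj_transpose_mult)
  have "c > 0"
  proof -
    obtain i where i: "T $ undefined $ i \<noteq> 0"
    proof (rule ccontr)
      assume "\<not> thesis"
      then have "\<And>i. T $ undefined $ i = 0" using that by blast
      then have "(T ** T') $ undefined $ undefined = 0" by (simp add: matrix_matrix_mult_def)
      then show False by (simp add: T' mat_def)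
    qed
    have "complex_of_real c = (T ** conj_transpose T) $ undefined $ undefined"
      by (simp add: c mat_def of_real_def)
    also have "\<dots> = of_real (\<Sum>i\<in>UNIV. (cmod (T $ undefined $ i))\<^sup>2)"
      by (simp add: matrix_matrix_mult_def complex_norm_square del: of_real_power)
    finally have "c = (\<Sum>i\<in>UNIV. (cmod (T $ undefined $ i))\<^sup>2)"
      by (simp only: of_real_eq_iff)
    also have "\<dots> > 0"
      using i by (intro sum_pos2[of _ i]) auto
    finally show ?thesis .
  qed
  define S where "S = (1 / sqrt c) *\<^sub>R T"
  have SS: "S ** conj_transpose S = mat 1"
    using \<open>c > 0\<close>
    by (simp add: S_def conj_transpose_scaleR matrix_scalar_ac scalar_matrix_assoc[symmetric] c power_divide flip: power2_eq_square)
  then have "unitary_matrix S"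
    using matrix_left_right_inverse by (auto simp: unitary_matrix_def)
  moreover have "\<Gamma>' g = conj_transpose S ** \<Gamma> g ** S" if g: "g \<in> carrier G" for g
  proof -
    have "S ** \<Gamma>' g = \<Gamma> g ** S"
      by (simp add: S_def matrix_scalar_ac scalar_matrix_assoc[symmetric] int[OF g])
    then show ?thesis
      using \<open>unitary_matrix S\<close> by (metis matrix_mul_assoc matrix_mul_lid unitary_matrix_def)
  qed
  ultimately show thesis using that by blast
qed

lemma unitary_rep_conj:
  assumes "unitary_rep G \<Gamma>" "unitary_matrix S"
  shows "unitary_rep G (\<lambda>g. conj_transpose S ** \<Gamma> g ** S)"
proof -
  have S: "conj_transpose S ** S = mat 1" "S ** conj_transpose S = mat 1"
    using assms by (auto simp: unitary_matrix_def)
  then have S': "X ** S ** conj_transpose S = X" "X ** conj_transpose S ** S = X" for X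
    by (simp_all flip: matrix_mul_assoc)
  have G: "X ** \<Gamma> g ** conj_transpose (\<Gamma> g) = X" "X ** conj_transpose (\<Gamma> g) ** \<Gamma> g = X"
    if "g \<in> carrier G" for X g
    using unitary_rep_D[OF assms(1) that] by (simp_all flip: matrix_mul_assoc)
  show ?thesis
    unfolding unitary_rep_def hom_def unitary_group_def unitary_matrix_def
    by (auto simp: conj_transpose_mult matrix_mul_assoc S S' G unitary_rep_D[OF assms(1)])
qed

lemma irreducible_rep_conj:
  assumes irr: "irreducible_rep G \<Gamma>" and "unitary_matrix S"
  shows "irreducible_rep G (\<lambda>g. conj_transpose S ** \<Gamma> g ** S)"
  unfolding irreducible_rep_def
proof (intro allI impI, elim conjE)
  fix W assume W: "vec.subspace W"
    and inv: "\<forall>g\<in>carrier G. \<forall>v\<in>W. (conj_transpose S ** \<Gamma> g ** S) *v v \<in> W"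
  have S: "S *v (conj_transpose S *v v) = v" "conj_transpose S *v (S *v v) = v" for v
    using assms by (auto simp: unitary_matrix_def matrix_vector_mul_assoc)
  define W' where "W' = {v. conj_transpose S *v v \<in> W}"
  have "vec.subspace W'"
    using W by (auto simp: vec.subspace_def W'_def vec.add vec.scale)
  moreover have "\<Gamma> g *v v \<in> W'" if "g \<in> carrier G" "v \<in> W'" for g v
    using inv that(1) that(2)[unfolded W'_def]
    by (force simp: W'_def S simp flip: matrix_vector_mul_assoc)
  ultimately have "W' = {0} \<or> W' = UNIV"
    using irr by (auto simp: irreducible_rep_def)
  moreover have "W = (\<lambda>v. conj_transpose S *v v) ` W'"
    using S by (auto simp: W'_def image_iff) metis
  moreover have "range (\<lambda>v. conj_transpose S *v v) = UNIV"
    using S by (metis surjI)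
  ultimately show "W = {0} \<or> W = UNIV" by auto
qed

text \<open>
  The entries of row \<open>k\<close> are orthogonal functions on \<open>G\<close>: their Gram matrix is the sum of
  \<open>\<Gamma>(g)\<^sup>H E \<Gamma>(g)\<close> over \<open>G\<close>, with \<open>E\<close> the matrix unit at \<open>(k, k)\<close>, and this commutes with the
  representation. Positivity of \<open>c\<close> comes from the summand at the unit of the group.
\<close>

lemma schur_orthogonality:
  fixes G :: "('g, 'b) monoid_scheme" (structure)
    and \<Gamma> :: "'g \<Rightarrow> complex^'n^'n"
  assumes G: "group G" and fin: "finite (carrier G)"
    and rep: "unitary_rep G \<Gamma>" and irr: "irreducible_rep G \<Gamma>"
  obtains c :: real where "c > 0"
    and "\<And>i j. (\<Sum>g\<in>carrier G. cnj (\<Gamma> g $ k $ i) * \<Gamma> g $ k $ j) = (if i = j then of_real c else 0)"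
proof -
  interpret group G by (rule G)
  define E :: "complex^'n^'n" where "E = (\<chi> i j. if i = k \<and> j = k then 1 else 0)"
  have E: "conj_transpose E = E" by (simp add: E_def vec_eq_iff conj_commute)
  define M where "M = (\<Sum>g\<in>carrier G. conj_transpose (\<Gamma> g) ** E ** \<Gamma> g)"
  have M_nth: "M $ i $ j = (\<Sum>g\<in>carrier G. cnj (\<Gamma> g $ k $ i) * \<Gamma> g $ k $ j)" for i j
  proof -
    have "(A ** E ** B) $ i $ j = A $ i $ k * B $ k $ j" for A B :: "complex^'n^'n"
    proof -
      have "(A ** E) $ i $ l = (if l = k then A $ i $ k else 0)" for l
        by (simp add: matrix_matrix_mult_def E_def if_distrib[of "\<lambda>x. _ * x"] cong: if_cong)
      then show ?thesis
        by (simp add: matrix_matrix_mult_def[of "A ** E"] if_distrib[of "\<lambda>x. x * _"] cong: if_cong)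
    qed
    then show ?thesis by (simp add: M_def)
  qed
  have inv: "conj_transpose (\<Gamma> h) ** M ** \<Gamma> h = M" if h: "h \<in> carrier G" for h
  proof -
    have "conj_transpose (\<Gamma> h) ** M ** \<Gamma> h =
        (\<Sum>g\<in>carrier G. conj_transpose (\<Gamma> (g \<otimes> h)) ** E ** \<Gamma> (g \<otimes> h))"
      unfolding M_def mult_sum_matrix sum_matrix_mult
      by (intro sum.cong) (simp_all add: unitary_rep_D[OF rep] h conj_transpose_mult matrix_mul_assoc)
    also have "\<dots> = M"
      unfolding M_def
      by (rule sum.reindex_bij_witness[of _ "\<lambda>g. g \<otimes> inv h" "\<lambda>g. g \<otimes> h"])
         (auto simp: h m_assoc)
    finally show ?thesis .
  qed
  obtain c :: real where c: "M = c *\<^sub>R mat 1"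
  proof (rule schur_hermitian[OF irr, of M])
    show "conj_transpose M = M"
      by (simp add: M_def conj_transpose_sum conj_transpose_mult E matrix_mul_assoc)
    show "M ** \<Gamma> h = \<Gamma> h ** M" if h: "h \<in> carrier G" for h
    proof -
      have "\<Gamma> h ** M = (\<Gamma> h ** conj_transpose (\<Gamma> h)) ** (M ** \<Gamma> h)"
        by (subst inv[OF h, symmetric]) (simp add: matrix_mul_assoc)
      then show ?thesis by (simp add: unitary_rep_D[OF rep h])
    qed
  qed
  have "complex_of_real c = M $ k $ k"
    by (simp add: c mat_def of_real_def)
  also have "\<dots> = of_real (\<Sum>g\<in>carrier G. (cmod (\<Gamma> g $ k $ k))\<^sup>2)"
    by (simp add: M_nth complex_norm_square mult.commute del: of_real_power)
  finally have "c = (\<Sum>g\<in>carrier G. (cmod (\<Gamma> g $ k $ k))\<^sup>2)"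
    by (simp only: of_real_eq_iff)
  moreover have "\<Gamma> \<one> = mat 1"
  proof -
    have "\<Gamma> \<one> = (conj_transpose (\<Gamma> \<one>) ** \<Gamma> \<one>) ** \<Gamma> \<one>"
      by (simp add: unitary_rep_D[OF rep])
    also have "\<dots> = conj_transpose (\<Gamma> \<one>) ** \<Gamma> (\<one> \<otimes> \<one>)"
      by (simp only: unitary_rep_D(3)[OF rep one_closed one_closed] matrix_mul_assoc)
    finally show ?thesis by (simp add: unitary_rep_D[OF rep])
  qed
  then have "(\<Sum>g\<in>carrier G. (cmod (\<Gamma> g $ k $ k))\<^sup>2) > 0"
    by (intro sum_pos2[of _ "\<one>"]) (auto simp: fin mat_def)
  ultimately have "c > 0" by simp
  moreover have "(\<Sum>g\<in>carrier G. cnj (\<Gamma> g $ k $ i) * \<Gamma> g $ k $ j) = (if i = j then of_real c else 0)" for i j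
    by (simp add: M_nth[symmetric] c mat_def of_real_def)
  ultimately show thesis using that by blast
qed

section \<open>Symmetries of the Platonic solids\<close>

lemma extreme_points_linear_image_eq:
  assumes "linear f" "inj f"
  shows "f x extreme_point_of (f ` S) \<longleftrightarrow> x extreme_point_of S"
  using face_of_linear_image[OF assms, of "{x}" S] by (simp add: face_of_singleton)

lemma span_standard_axes_real3:
  fixes S :: "(real^3) set"
  assumes "vector [1, 0, 0] \<in> span S" "vector [0, 1, 0] \<in> span S" "vector [0, 0, 1] \<in> span S"
  shows "span S = UNIV"
proof -
  have "x \<in> span S" for x :: "real^3"
  proof -
    have "x = x $ 1 *\<^sub>R vector [1, 0, 0] + x $ 2 *\<^sub>R vector [0, 1, 0] + x $ 3 *\<^sub>R vector [0, 0, 1]"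
      by (simp add: vec_eq_iff forall_3)
    also have "\<dots> \<in> span S"
      by (intro span_add span_scale assms)
    finally show ?thesis .
  qed
  then show ?thesis by blast
qed

text \<open>
  Each coordinate axis contains the midpoint of two vertices of the tetrahedron and of the
  icosahedron; the cube and the dodecahedron contain the vertices of the tetrahedron.
\<close>

lemma span_vertices:
  assumes "V \<in> {tetrahedron_vertices, cube_vertices, octahedron_vertices,
                  icosahedron_vertices, dodecahedron_vertices}"
  shows "span V = UNIV"
proof -
  have half: "u \<in> span S" if "v \<in> S" "w \<in> S" "u = (1/2) *\<^sub>R (v + w)" for u v w :: "real^3" and S
    unfolding that(3) by (intro span_scale span_add span_base that)
  have tetra: "span tetrahedron_vertices = UNIV"
  proof (rule span_standard_axes_real3)
    show "vector [1, 0, 0] \<in> span tetrahedron_vertices"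
      by (rule half[of "vector [1, 1, 1]" _ "vector [1, - 1, - 1]"])
         (auto simp: tetrahedron_vertices_def vec_eq_iff forall_3)
    show "vector [0, 1, 0] \<in> span tetrahedron_vertices"
      by (rule half[of "vector [1, 1, 1]" _ "vector [- 1, 1, - 1]"])
         (auto simp: tetrahedron_vertices_def vec_eq_iff forall_3)
    show "vector [0, 0, 1] \<in> span tetrahedron_vertices"
      by (rule half[of "vector [1, 1, 1]" _ "vector [- 1, - 1, 1]"])
         (auto simp: tetrahedron_vertices_def vec_eq_iff forall_3)
  qed
  have octa: "span octahedron_vertices = UNIV"
    by (rule span_standard_axes_real3; rule span_base) (auto simp: octahedron_vertices_def)
  have ico: "span icosahedron_vertices = UNIV"
  proof (rule span_standard_axes_real3)
    show "vector [1, 0, 0] \<in> span icosahedron_vertices"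
      by (rule half[of "vector [1, phi, 0]" _ "vector [1, - phi, 0]"])
         (auto simp: icosahedron_vertices_def vec_eq_iff forall_3)
    show "vector [0, 1, 0] \<in> span icosahedron_vertices"
      by (rule half[of "vector [0, 1, phi]" _ "vector [0, 1, - phi]"])
         (auto simp: icosahedron_vertices_def vec_eq_iff forall_3)
    show "vector [0, 0, 1] \<in> span icosahedron_vertices"
      by (rule half[of "vector [phi, 0, 1]" _ "vector [- phi, 0, 1]"])
         (auto simp: icosahedron_vertices_def vec_eq_iff forall_3)
  qed
  have "tetrahedron_vertices \<subseteq> cube_vertices"
    by (auto simp: tetrahedron_vertices_def cube_vertices_def)
  then have "span cube_vertices = UNIV"
    using tetra span_mono by blast
  moreover from this have "span dodecahedron_vertices = UNIV"
    using span_mono[of cube_vertices dodecahedron_vertices] by (auto simp: dodecahedron_vertices_def)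
  ultimately show ?thesis using assms tetra octa ico by auto
qed

lemma finite_vertices:
  assumes "V \<in> {tetrahedron_vertices, cube_vertices, octahedron_vertices,
                  icosahedron_vertices, dodecahedron_vertices}"
  shows "finite V"
proof -
  have "finite (\<Union>a\<in>{-1, 1}. \<Union>b\<in>{-1, 1}. \<Union>c\<in>{-1, 1}. {vector [a, b, c] :: real^3})"
    by (intro finite_UN_I) simp_all
  also have "(\<Union>a\<in>{-1, 1}. \<Union>b\<in>{-1, 1}. \<Union>c\<in>{-1, 1}. {vector [a, b, c]}) = cube_vertices"
    by (auto simp: cube_vertices_def)
  finally have "finite cube_vertices" .
  then show ?thesis
    using assms by (auto simp: tetrahedron_vertices_def octahedron_vertices_def
        icosahedron_vertices_def dodecahedron_vertices_def)
qed

text \<open>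
  A linear symmetry of a polytope permutes its extreme points, which are finitely many and
  span the space, so it is determined by a map of a finite set into itself.
\<close>

lemma finite_linear_symmetries:
  fixes V :: "(real^'n) set"
  assumes "finite V" "span V = UNIV"
  shows "finite {A :: real^'n^'n. invertible A \<and> (*v) A ` (convex hull V) = convex hull V}"
proof -
  define E where "E = {x. x extreme_point_of (convex hull V)}"
  have fin: "finite E"
    unfolding E_def using extreme_points_of_convex_hull assms(1) by (rule finite_subset)
  have "V \<subseteq> convex hull V" by (rule hull_subset)
  also have "\<dots> = convex hull E"
    unfolding E_def by (rule Krein_Milman_polytope[OF assms(1)])
  also have "\<dots> \<subseteq> span E" by (rule convex_hull_subset_span)
  finally have span: "span E = UNIV"
    using assms(2) span_minimal[OF _ subspace_span] by blast
  let ?S = "{A :: real^'n^'n. invertible A \<and> (*v) A ` (convex hull V) = convex hull V}"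
  have "inj_on (\<lambda>A. restrict ((*v) A) E) ?S"
  proof (rule inj_onI)
    fix A B :: "real^'n^'n"
    assume "restrict ((*v) A) E = restrict ((*v) B) E"
    then have "A *v x = B *v x" if "x \<in> E" for x
      using that by (metis restrict_apply')
    then have "A *v x = B *v x" for x
      using linear_eq_on_span[of "(*v) A" "(*v) B" E x] span by simp
    then show "A = B" by (simp add: matrix_eq)
  qed
  moreover have "(\<lambda>A. restrict ((*v) A) E) ` ?S \<subseteq> E \<rightarrow>\<^sub>E E"
  proof (clarsimp)
    fix A :: "real^'n^'n" and x
    assume A: "invertible A" "(*v) A ` (convex hull V) = convex hull V" and "x \<in> E"
    then show "A *v x \<in> E"
      using extreme_points_linear_image_eq[OF matrix_vector_mul_linear inj_matrix_vector_mult[OF A(1)],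
          of x "convex hull V"]
      by (simp add: E_def)
  qed
  ultimately show ?thesis
    using fin by (meson finite_PiE finite_imageD finite_subset)
qed

lemma finite_rotation_group:
  assumes "platonic_solid P"
  shows "finite (carrier (rotation_group P))"
proof -
  obtain V c Q where V: "V \<in> {tetrahedron_vertices, cube_vertices, octahedron_vertices,
                  icosahedron_vertices, dodecahedron_vertices}"
    and c: "0 < c" and Q: "orthogonal_matrix Q" and P: "P = (\<lambda>x. c *\<^sub>R (Q *v x)) ` (convex hull V)"
    using assms unfolding platonic_solid_def by blast
  define f where "f x = c *\<^sub>R (Q *v x)" for x
  have lin: "linear f"
    unfolding f_def by (intro linear_compose_scale_right matrix_vector_mul_linear)
  have "surj f"
  proof (rule surjI)
    fix y show "f (transpose Q *v ((1 / c) *\<^sub>R y)) = y"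
      using c Q
      by (simp add: f_def matrix_vector_mul_assoc matrix_vector_mult_scaleR orthogonal_matrix_def
               del: transpose_matrix_vector)
  qed
  have "P = convex hull (f ` V)"
    using P convex_hull_linear_image[OF lin, of V] by (simp add: f_def)
  moreover have "span (f ` V) = UNIV"
    using linear_span_image[OF lin, of V] span_vertices[OF V] \<open>surj f\<close> by simp
  moreover have "finite (f ` V)" using finite_vertices[OF V] by simp
  moreover have "invertible A" if "rotation_matrix A" for A :: "real^3^3"
    using that by (auto simp: rotation_matrix_def orthogonal_matrix_def invertible_def)
  ultimately show ?thesis
    using finite_linear_symmetries[of "f ` V"]
    by (auto simp: rotation_group_def elim: rev_finite_subset)
qed

text \<open>
  Each set of fixed points is a proper subspace, so it has measure zero, and finitely many
  of them do not cover the space.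
\<close>

lemma exists_point_moved_by_all:
  fixes S :: "(real^'n^'n) set"
  assumes "finite S" "mat 1 \<notin> S"
  obtains x where "norm x = 1" "\<And>A. A \<in> S \<Longrightarrow> A *v x \<noteq> x"
proof -
  have "negligible {x. A *v x = x}" if "A \<in> S" for A
  proof (rule negligible_lowdim)
    have "span {x. A *v x = x} = {x. A *v x = x}"
      by (intro span_eq_iff[THEN iffD2])
         (auto simp: subspace_def matrix_vector_right_distrib matrix_vector_mult_scaleR)
    moreover have "{x. A *v x = x} \<noteq> UNIV"
      using assms(2) that matrix_eq[of A "mat 1"] by auto
    ultimately have "dim {x. A *v x = x} \<noteq> DIM(real^'n)"
      by (simp only: dim_eq_full not_False_eq_True)
    then show "dim {x. A *v x = x} < DIM(real^'n)"
      using dim_subset_UNIV[of "{x. A *v x = x}"] by linarith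
  qed
  then have "negligible (\<Union>A\<in>S. {x. A *v x = x})"
    using assms(1) by (intro negligible_Union) auto
  then have "(\<Union>A\<in>S. {x. A *v x = x}) \<union> {0} \<noteq> (UNIV :: (real^'n) set)"
    using non_negligible_UNIV negligible_Un[OF _ negligible_sing[of 0]] by (metis (no_types))
  then obtain y where y: "y \<noteq> 0" "\<And>A. A \<in> S \<Longrightarrow> A *v y \<noteq> y" by auto
  show thesis
  proof
    show "norm (y /\<^sub>R norm y) = 1" using y by simp
    show "A *v (y /\<^sub>R norm y) \<noteq> y /\<^sub>R norm y" if "A \<in> S" for A
      using y(1) y(2)[OF that] by (simp add: matrix_vector_mult_scaleR)
  qed
qed

section \<open>Area on the unit sphere and step functions\<close>

lemma orthogonal_matrix_norm:
  fixes A :: "real^'n^'n"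
  assumes "orthogonal_matrix A"
  shows "norm (A *v x) = norm x"
  using assms orthogonal_transformation_norm[of "(*v) A"]
  by (simp add: orthogonal_transformation_matrix)

lemma space_sphere_measure [simp]: "space sphere_measure = sphere 0 1"
  by (simp add: sphere_measure_def space_restrict_space)

lemma sets_sphere_measure [measurable_cong]: "sets sphere_measure = sets (restrict_space borel (sphere 0 1))"
  by (simp add: sphere_measure_def)

lemma finite_measure_sphere_measure: "finite_measure sphere_measure"
  by (rule finite_measureI) (simp add: emeasure_sphere_measure_sphere)

text \<open>
  The cone in the punctured unit ball through which the area on the sphere is defined;
  rotation invariance and positivity of area are inherited from volume through it.
\<close>

definition unit_cone :: "(real^3) set \<Rightarrow> (real^3) set" where
  "unit_cone A = {x \<in> cball 0 1 - {0}. x /\<^sub>R norm x \<in> A}"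

lemma unit_cone_borel:
  assumes "A \<in> sets borel" shows "unit_cone A \<in> sets borel"
proof -
  have "(\<lambda>x::real^3. x /\<^sub>R norm x) -` A \<inter> space borel \<in> sets borel"
    by (rule measurable_sets[OF _ assms]) measurable
  then have "(cball 0 1 - {0}) \<inter> ((\<lambda>x::real^3. x /\<^sub>R norm x) -` A \<inter> space borel) \<in> sets borel"
    by (intro sets.Int) auto
  also have "(cball 0 1 - {0}) \<inter> ((\<lambda>x::real^3. x /\<^sub>R norm x) -` A \<inter> space borel) = unit_cone A"
    by (auto simp: unit_cone_def)
  finally show ?thesis .
qed

lemma measure_sphere_measure:
  assumes "A \<in> sets borel" "A \<subseteq> sphere 0 1"
  shows "measure sphere_measure A = 3 * measure lborel (unit_cone A)"
  using emeasure_sphere_measure[OF assms]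
  by (simp add: measure_def unit_cone_def enn2real_mult)

lemma unit_cone_lmeasurable:
  assumes "A \<in> sets borel" shows "unit_cone A \<in> lmeasurable"
proof (rule fmeasurableI2)
  show "cball 0 1 \<in> lmeasurable" by simp
qed (use unit_cone_borel[OF assms] in \<open>auto simp: unit_cone_def\<close>)

lemma unit_cone_orthogonal_image:
  assumes Q: "orthogonal_matrix Q"
  shows "unit_cone ((*v) Q ` A) = (*v) Q ` unit_cone A"
proof -
  have inv: "Q *v (transpose Q *v x) = x" "transpose Q *v (Q *v x) = x" for x
    using Q by (simp_all add: matrix_vector_mul_assoc orthogonal_matrix_def del: transpose_matrix_vector)
  have mem: "x \<in> (*v) Q ` B \<longleftrightarrow> transpose Q *v x \<in> B" for x B
    using inv by (metis image_iff)
  have Q': "orthogonal_matrix (transpose Q)" using Q by simp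
  have zero: "transpose Q *v x = 0 \<longleftrightarrow> x = 0" for x
    using orthogonal_matrix_norm[OF Q', of x] by (metis norm_eq_zero)
  show ?thesis
    by (rule Set.set_eqI)
       (simp add: mem zero unit_cone_def orthogonal_matrix_norm[OF Q'] matrix_vector_mult_scaleR
          del: transpose_matrix_vector)
qed

lemma measure_sphere_measure_orthogonal_image:
  assumes Q: "orthogonal_matrix Q" and A: "A \<in> sets borel" "A \<subseteq> sphere 0 1"
    and QA: "(*v) Q ` A \<in> sets borel"
  shows "measure sphere_measure ((*v) Q ` A) = measure sphere_measure A"
proof -
  have "(*v) Q ` A \<subseteq> sphere 0 1"
    using A(2) orthogonal_matrix_norm[OF Q] by auto
  then have "measure sphere_measure ((*v) Q ` A) = 3 * measure lebesgue ((*v) Q ` unit_cone A)"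
    using measure_sphere_measure[OF QA] unit_cone_borel[OF QA]
    by (simp add: unit_cone_orthogonal_image[OF Q])
  also have "\<dots> = 3 * measure lebesgue (unit_cone A)"
    using Q by (simp add: measure_orthogonal_image unit_cone_lmeasurable[OF A(1)] orthogonal_transformation_matrix)
  also have "\<dots> = measure sphere_measure A"
    using measure_sphere_measure[OF A] unit_cone_borel[OF A(1)] by simp
  finally show ?thesis .
qed

definition spherical_cap :: "real^3 \<Rightarrow> real \<Rightarrow> (real^3) set" where
  "spherical_cap x e = ball x e \<inter> sphere 0 1"

lemma spherical_cap_borel: "spherical_cap x e \<in> sets borel"
  by (simp add: spherical_cap_def)

lemma spherical_cap_sets: "spherical_cap x e \<in> sets sphere_measure"
  by (auto simp: spherical_cap_def sets_sphere_measure sets_restrict_space_iff)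

lemma spherical_cap_orthogonal_image:
  assumes Q: "orthogonal_matrix Q"
  shows "spherical_cap (Q *v x) e = (*v) Q ` spherical_cap x e"
proof -
  have inv: "Q *v (transpose Q *v x) = x" for x
    using Q by (simp add: matrix_vector_mul_assoc orthogonal_matrix_def del: transpose_matrix_vector)
  have "dist (Q *v x) (Q *v y) = dist x y" for y
    using orthogonal_matrix_norm[OF Q, of "x - y"] by (simp add: dist_norm matrix_vector_mult_diff_distrib)
  then have *: "Q *v y \<in> spherical_cap (Q *v x) e \<longleftrightarrow> y \<in> spherical_cap x e" for y
    by (simp add: spherical_cap_def orthogonal_matrix_norm[OF Q])
  show ?thesis
    using * inv by (metis (no_types, lifting) image_eqI subsetI subset_antisym image_subsetI)
qed

lemma measure_spherical_cap_orthogonal: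
  assumes "orthogonal_matrix Q"
  shows "measure sphere_measure (spherical_cap (Q *v x) e) = measure sphere_measure (spherical_cap x e)"
  unfolding spherical_cap_orthogonal_image[OF assms]
proof (rule measure_sphere_measure_orthogonal_image[OF assms spherical_cap_borel])
  show "(*v) Q ` spherical_cap x e \<in> sets borel"
    using spherical_cap_borel[of "Q *v x" e] by (simp add: spherical_cap_orthogonal_image[OF assms])
qed (auto simp: spherical_cap_def)

lemma measure_spherical_cap_pos:
  assumes x: "norm x = 1" and e: "e > 0"
  shows "measure sphere_measure (spherical_cap x e) > 0"
proof -
  define D where "D = {y \<in> ball 0 1 - {0}. y /\<^sub>R norm y \<in> ball x e}"
  have "open ((ball 0 1 - {0}) \<inter> (\<lambda>y. y /\<^sub>R norm y) -` ball x e)"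
    by (rule continuous_open_preimage) (auto intro!: continuous_intros)
  also have "(ball 0 1 - {0}) \<inter> (\<lambda>y. y /\<^sub>R norm y) -` ball x e = D"
    by (auto simp: D_def)
  finally have "open D" .
  moreover have "(1/2) *\<^sub>R x \<in> D"
    using x e by (auto simp: D_def)
  ultimately have "\<not> negligible D"
    using open_not_negligible by blast
  moreover have "D \<subseteq> unit_cone (spherical_cap x e)"
    by (auto simp: D_def unit_cone_def spherical_cap_def)
  ultimately have "\<not> negligible (unit_cone (spherical_cap x e))"
    using negligible_subset by blast
  then have "measure lebesgue (unit_cone (spherical_cap x e)) \<noteq> 0"
    using unit_cone_lmeasurable[OF spherical_cap_borel] negligible_iff_measure0 by blast
  then have "measure lborel (unit_cone (spherical_cap x e)) > 0"
    using unit_cone_borel[OF spherical_cap_borel] by (simp add: zero_less_measure_iff)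
  then show ?thesis
    using measure_sphere_measure[OF spherical_cap_borel, of x e] by (auto simp: spherical_cap_def)
qed

lemma square_integrable_step:
  assumes "finite_measure M" "finite J" and B: "\<And>g. g \<in> J \<Longrightarrow> B g \<in> sets M"
  shows "square_integrable M (\<lambda>x. \<Sum>g\<in>J. indicator (B g) x *\<^sub>R (a g :: complex))"
proof -
  interpret finite_measure M by fact
  let ?f = "\<lambda>x. \<Sum>g\<in>J. indicator (B g) x *\<^sub>R (a g :: complex)"
  have meas: "?f \<in> borel_measurable M"
    using B by (intro borel_measurable_sum borel_measurable_scaleR borel_measurable_indicator) auto
  moreover have "integrable M (\<lambda>x. (cmod (?f x))\<^sup>2)"
  proof (rule integrable_const_bound)
    have "cmod (?f x) \<le> (\<Sum>g\<in>J. cmod (a g))" for x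
      by (rule order_trans[OF norm_sum sum_mono]) (auto simp: indicator_def)
    then show "AE x in M. norm ((cmod (?f x))\<^sup>2) \<le> (\<Sum>g\<in>J. cmod (a g))\<^sup>2"
      by (intro AE_I2) (simp add: power_mono)
  qed (use meas in measurable)
  ultimately show ?thesis by (simp add: square_integrable_def)
qed

text \<open>
  Two step functions over the same disjoint sets: only equal indices meet, so the double sum
  collapses to a single one.
\<close>

lemma L2_inner_step:
  assumes "finite_measure M" "finite J" and B: "\<And>g. g \<in> J \<Longrightarrow> B g \<in> sets M"
    and disj: "disjoint_family_on B J"
  shows "L2_inner M (\<lambda>x. \<Sum>g\<in>J. indicator (B g) x *\<^sub>R a g) (\<lambda>x. \<Sum>g\<in>J. indicator (B g) x *\<^sub>R b g) =
    (\<Sum>g\<in>J. measure M (B g) *\<^sub>R (cnj (a g) * b g))"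
proof -
  interpret finite_measure M by fact
  have int_ind: "(LINT x|M. indicator A x *\<^sub>R c) = measure M A *\<^sub>R c" if "A \<in> sets M" for A and c :: complex
    using that sets.sets_into_space[OF that]
    by (subst integral_scaleR_left) (auto simp: Int_absorb2 emeasure_eq_measure)
  have "cnj (\<Sum>g\<in>J. indicator (B g) x *\<^sub>R a g) * (\<Sum>g\<in>J. indicator (B g) x *\<^sub>R b g) =
      (\<Sum>g\<in>J. indicator (B g) x *\<^sub>R (cnj (a g) * b g))" for x
  proof (cases "\<exists>h\<in>J. x \<in> B h")
    case True
    then obtain h where h: "h \<in> J" "x \<in> B h" by blast
    have "indicator (B g) x *\<^sub>R c = (if g = h then c else 0)" if "g \<in> J" for g and c :: complex
      using that h disj by (auto simp: indicator_def disjoint_family_on_def)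
    then show ?thesis using h assms(2) by simp
  next
    case False
    then show ?thesis by (simp add: indicator_def)
  qed
  then have "L2_inner M (\<lambda>x. \<Sum>g\<in>J. indicator (B g) x *\<^sub>R a g) (\<lambda>x. \<Sum>g\<in>J. indicator (B g) x *\<^sub>R b g) =
      (LINT x|M. (\<Sum>g\<in>J. indicator (B g) x *\<^sub>R (cnj (a g) * b g)))"
    by (simp only: L2_inner_def)
  also have "\<dots> = (\<Sum>g\<in>J. LINT x|M. indicator (B g) x *\<^sub>R (cnj (a g) * b g))"
    using B by (intro Bochner_Integration.integral_sum integrable_indicator) (auto simp: emeasure_eq_measure)
  also have "\<dots> = (\<Sum>g\<in>J. measure M (B g) *\<^sub>R (cnj (a g) * b g))"
    using B by (intro sum.cong refl int_ind)
  finally show ?thesis .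
qed

lemma integrable_cnj_mult:
  assumes "square_integrable M f" "square_integrable M h"
  shows "integrable M (\<lambda>x. cnj (f x) * h x)"
proof (rule Bochner_Integration.integrable_bound)
  show "integrable M (\<lambda>x. (cmod (f x))\<^sup>2 + (cmod (h x))\<^sup>2)"
    using assms by (simp add: square_integrable_def)
  have [measurable]: "f \<in> borel_measurable M" "h \<in> borel_measurable M"
    using assms by (simp_all add: square_integrable_def)
  have "cnj \<in> borel_measurable borel"
    by (intro borel_measurable_continuous_onI continuous_intros)
  then have "(\<lambda>x. cnj (f x)) \<in> borel_measurable M"
    by (rule measurable_compose[rotated]) measurable
  then show "(\<lambda>x. cnj (f x) * h x) \<in> borel_measurable M"
    by (intro borel_measurable_times) auto
  have "a * b \<le> a\<^sup>2 + b\<^sup>2" if "0 \<le> a" "0 \<le> b" for a b :: real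
  proof -
    have "2 * (a * b) \<le> a\<^sup>2 + b\<^sup>2" using sum_squares_bound[of a b] by simp
    moreover have "0 \<le> a * b" using that by simp
    ultimately show ?thesis by linarith
  qed
  then show "AE x in M. norm (cnj (f x) * h x) \<le> norm ((cmod (f x))\<^sup>2 + (cmod (h x))\<^sup>2)"
    by (intro AE_I2) (simp add: norm_mult)
qed

text \<open>
  Orthonormality makes the components linearly independent as functions: pairing a vanishing
  combination with the component \<open>k\<close> isolates its coefficient \<open>c k\<close>.
\<close>

lemma orthonormal_independent:
  fixes I :: "'a \<Rightarrow> complex^'d"
  assumes sq: "\<And>i. square_integrable M (\<lambda>x. I x $ i)"
    and on: "\<And>i j. L2_inner M (\<lambda>x. I x $ i) (\<lambda>x. I x $ j) = (if i = j then 1 else 0)"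
    and zero: "\<And>x. x \<in> space M \<Longrightarrow> (\<Sum>j\<in>UNIV. c j * I x $ j) = 0"
  shows "c k = 0"
proof -
  have "(LINT x|M. (\<Sum>j\<in>UNIV. c j * (cnj (I x $ k) * I x $ j))) =
      (\<Sum>j\<in>UNIV. c j * (LINT x|M. cnj (I x $ k) * I x $ j))"
    by (subst Bochner_Integration.integral_sum)
       (auto intro!: integrable_mult_right integrable_cnj_mult sq)
  also have "\<dots> = (\<Sum>j\<in>UNIV. if k = j then c j else 0)"
    by (intro sum.cong refl) (simp add: on[unfolded L2_inner_def])
  also have "\<dots> = c k" by simp
  also have "(LINT x|M. (\<Sum>j\<in>UNIV. c j * (cnj (I x $ k) * I x $ j))) = (LINT x|M. 0)"
  proof (rule Bochner_Integration.integral_cong[OF refl])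
    fix x assume "x \<in> space M"
    have "(\<Sum>j\<in>UNIV. c j * (cnj (I x $ k) * I x $ j)) = cnj (I x $ k) * (\<Sum>j\<in>UNIV. c j * I x $ j)"
      by (simp add: sum_distrib_left mult_ac)
    then show "(\<Sum>j\<in>UNIV. c j * (cnj (I x $ k) * I x $ j)) = 0"
      using zero[OF \<open>x \<in> space M\<close>] by simp
  qed
  finally show ?thesis by simp
qed

section \<open>Real basis functions of polyhedral groups\<close>

lemma polyhedral_groupD:
  fixes G :: "('g, 'b) monoid_scheme" (structure)
  assumes "polyhedral_group G R"
  shows "group G" and "finite (carrier G)" and "inj_on R (carrier G)"
    and "\<And>g. g \<in> carrier G \<Longrightarrow> orthogonal_matrix (R g)"
    and "\<And>g h. g \<in> carrier G \<Longrightarrow> h \<in> carrier G \<Longrightarrow> R (g \<otimes> h) = R g ** R h"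
    and "R \<one> = mat 1"
    and "\<And>g. g \<in> carrier G \<Longrightarrow> matrix_inv (R g) = R (inv g)"
proof -
  obtain P where G: "group G" and P: "platonic_solid P" and iso: "R \<in> iso G (rotation_group P)"
    using assms by (auto simp: polyhedral_group_def)
  interpret group G by (rule G)
  show "group G" by (rule G)
  have bij: "bij_betw R (carrier G) (carrier (rotation_group P))" and hom: "R \<in> hom G (rotation_group P)"
    using iso by (auto simp: iso_def)
  show "finite (carrier G)"
    using bij finite_rotation_group[OF P] bij_betw_finite by blast
  show "inj_on R (carrier G)" using bij by (rule bij_betw_imp_inj_on)
  show "orthogonal_matrix (R g)" if "g \<in> carrier G" for g
    using hom_in_carrier[OF hom that] by (auto simp: rotation_group_def rotation_matrix_def)
  show mult: "R (g \<otimes> h) = R g ** R h" if "g \<in> carrier G" "h \<in> carrier G" for g h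
    using hom_mult[OF hom that] by (simp add: rotation_group_def)
  show one: "R \<one> = mat 1"
    using hom_one[OF hom G group_rotation_group] by (simp add: rotation_group_def)
  show "matrix_inv (R g) = R (inv g)" if "g \<in> carrier G" for g
    using that by (intro matrix_inv_eqI) (simp add: one flip: mult)
qed

lemma finite_set_separated:
  fixes S :: "'a::metric_space set"
  assumes "finite S"
  obtains e :: real where "e > 0" "\<forall>x\<in>S. \<forall>y\<in>S. x \<noteq> y \<longrightarrow> 2 * e \<le> dist x y"
proof -
  \<comment> \<open>The element 2 only keeps the set nonempty when \<open>S\<close> has fewer than two points.\<close>
  define D where "D = insert 2 ((\<lambda>(x, y). dist x y) ` {(x, y) \<in> S \<times> S. x \<noteq> y})"
  have "finite {(x, y) \<in> S \<times> S. x \<noteq> y}"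
    by (rule finite_subset[of _ "S \<times> S"]) (use assms in auto)
  then have fin: "finite D" by (simp add: D_def)
  have "Min D > 0"
    using fin by (subst Min_gr_iff) (auto simp: D_def)
  moreover have "Min D \<le> dist x y" if "x \<in> S" "y \<in> S" "x \<noteq> y" for x y
  proof (rule Min_le[OF fin])
    show "dist x y \<in> D" using that by (force simp: D_def)
  qed
  ultimately show thesis
    by (intro that[of "Min D / 2"]) auto
qed

text \<open>
  A point \<open>x\<close> moved by every nontrivial rotation has an orbit on which the group acts simply
  transitively, and small caps around the finitely many points of that orbit do not meet.
  The caps are indexed by \<open>g\<close> with centre \<open>R (inv g) x\<close>, so that applying \<open>R (inv h)\<close>
  becomes right multiplication by \<open>h\<close> on the index.
\<close>

lemma polyhedral_group_disjoint_caps: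
  fixes G :: "('g, 'b) monoid_scheme" (structure)
  assumes "polyhedral_group G R"
  obtains x e where "norm x = 1" "e > 0"
    "disjoint_family_on (\<lambda>g. spherical_cap (R (inv g) *v x) e) (carrier G)"
proof -
  note R = polyhedral_groupD[OF assms]
  interpret group G by (rule R(1))
  have "mat 1 \<notin> R ` (carrier G - {\<one>})"
  proof
    assume "mat 1 \<in> R ` (carrier G - {\<one>})"
    then obtain g where "g \<in> carrier G" "g \<noteq> \<one>" "R g = R \<one>"
      using R(6) by (metis DiffE image_iff singletonI)
    then show False using R(3) by (auto dest: inj_onD)
  qed
  then obtain x where x: "norm x = 1" "\<And>g. g \<in> carrier G - {\<one>} \<Longrightarrow> R g *v x \<noteq> x"
    using exists_point_moved_by_all[of "R ` (carrier G - {\<one>})"] R(2)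
    by (metis finite_Diff finite_imageI imageI)
  have inj: "R (inv g) *v x \<noteq> R (inv h) *v x" if "g \<in> carrier G" "h \<in> carrier G" "g \<noteq> h" for g h
  proof
    assume eq: "R (inv g) *v x = R (inv h) *v x"
    have "R (g \<otimes> inv h) *v x = R g *v (R (inv g) *v x)"
      using that by (simp add: eq matrix_vector_mul_assoc R(5))
    also have "\<dots> = R (g \<otimes> inv g) *v x"
      using that by (simp add: matrix_vector_mul_assoc flip: R(5))
    also have "\<dots> = x" using that by (simp add: R(6))
    finally have "g \<otimes> inv h = \<one>" using x(2)[of "g \<otimes> inv h"] that by auto
    then show False using that inv_equality[of g "inv h"] by simp
  qed
  have "finite ((\<lambda>g. R (inv g) *v x) ` carrier G)" using R(2) by simp
  then obtain e :: real where e: "e > 0"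
    "\<forall>y\<in>(\<lambda>g. R (inv g) *v x) ` carrier G. \<forall>z\<in>(\<lambda>g. R (inv g) *v x) ` carrier G.
        y \<noteq> z \<longrightarrow> 2 * e \<le> dist y z"
    by (rule finite_set_separated)
  have "spherical_cap (R (inv g) *v x) e \<inter> spherical_cap (R (inv h) *v x) e = {}"
    if "g \<in> carrier G" "h \<in> carrier G" "g \<noteq> h" for g h
  proof -
    have "2 * e \<le> dist (R (inv g) *v x) (R (inv h) *v x)"
      using that inj[OF that] by (intro e(2)[rule_format]) auto
    then have "\<not> (dist (R (inv g) *v x) y < e \<and> dist (R (inv h) *v x) y < e)" for y
      using dist_triangle2[of "R (inv g) *v x" "R (inv h) *v x" y] by linarith
    then show ?thesis
      unfolding spherical_cap_def by (meson Int_iff disjoint_iff mem_ball)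
  qed
  then have "disjoint_family_on (\<lambda>g. spherical_cap (R (inv g) *v x) e) (carrier G)"
    by (simp add: disjoint_family_on_def)
  then show thesis by (rule that[OF x(1) e(1)])
qed

text \<open>
  The regular representation sits in the step functions on the disjoint caps, and a row of
  matrix entries picks out the given irreducible representation in it: up to a factor, \<open>I\<close>
  takes on the cap of \<open>g\<close> the constant value given by row \<open>k\<close> of \<open>\<Gamma> g\<close>. Equivariance is the
  multiplication rule of \<open>\<Gamma>\<close>, orthogonality of the components is Schur orthogonality
  together with the equal areas of the caps, and reality of \<open>I\<close> is reality of \<open>\<Gamma>\<close>.
\<close>

lemma real_basis_function_exists:
  fixes G :: "('g, 'b) monoid_scheme" (structure) and \<Gamma> \<Gamma>\<^sub>c :: "'g \<Rightarrow> complex^'d^'d"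
  assumes poly: "polyhedral_group G R" and rep: "unitary_rep G \<Gamma>" and irr: "irreducible_rep G \<Gamma>"
    and equiv: "equivalent_reps G \<Gamma>\<^sub>c \<Gamma>" and real: "\<And>g. g \<in> carrier G \<Longrightarrow> real_matrix (\<Gamma> g)"
  shows "\<exists>I. real_basis_function G R \<Gamma>\<^sub>c I"
proof -
  note R = polyhedral_groupD[OF poly]
  interpret group G by (rule R(1))
  obtain x0 e where x0: "norm x0 = 1" and e: "e > 0"
    and disj: "disjoint_family_on (\<lambda>g. spherical_cap (R (inv g) *v x0) e) (carrier G)"
    using polyhedral_group_disjoint_caps[OF poly] .
  \<comment> \<open>Every row of \<open>\<Gamma>\<close> serves equally well.\<close>
  fix k :: 'd
  obtain c :: real where c: "c > 0"
    and orth: "\<And>i j. (\<Sum>g\<in>carrier G. cnj (\<Gamma> g $ k $ i) * \<Gamma> g $ k $ j) = (if i = j then of_real c else 0)"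
    using schur_orthogonality[OF R(1,2) rep irr, of k] by blast
  define B where "B g = spherical_cap (R (inv g) *v x0) e" for g
  define m where "m = measure sphere_measure (spherical_cap x0 e)"
  have m: "m > 0" unfolding m_def by (rule measure_spherical_cap_pos[OF x0 e])
  have Bm: "measure sphere_measure (B g) = m" if "g \<in> carrier G" for g
    unfolding B_def m_def using that R(4) by (intro measure_spherical_cap_orthogonal) simp
  have Bs: "B g \<in> sets sphere_measure" for g
    by (simp add: B_def spherical_cap_sets)
  \<comment> \<open>The components have squared norm \<open>m c\<close> before scaling: \<open>m\<close> from the area of a cap, \<open>c\<close> from
      Schur orthogonality.\<close>
  define N where "N = 1 / sqrt (m * c)"
  have N: "m * N\<^sup>2 * c = 1" using m c by (simp add: N_def power_divide)
  define I :: "real^3 \<Rightarrow> complex^'d" where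
    "I x = (\<chi> i. \<Sum>g\<in>carrier G. indicator (B g) x *\<^sub>R (N *\<^sub>R \<Gamma> g $ k $ i))" for x
  have "square_integrable sphere_measure (\<lambda>x. I x $ i)" for i
    unfolding I_def vec_lambda_beta
    by (rule square_integrable_step[OF finite_measure_sphere_measure R(2) Bs])
  moreover have "L2_inner sphere_measure (\<lambda>x. I x $ i) (\<lambda>x. I x $ j) = (if i = j then 1 else 0)" for i j
  proof -
    have "L2_inner sphere_measure (\<lambda>x. I x $ i) (\<lambda>x. I x $ j) =
        (\<Sum>g\<in>carrier G. measure sphere_measure (B g) *\<^sub>R (cnj (N *\<^sub>R \<Gamma> g $ k $ i) * N *\<^sub>R \<Gamma> g $ k $ j))"
      unfolding I_def vec_lambda_beta
      by (rule L2_inner_step[OF finite_measure_sphere_measure R(2) Bs]) (use disj in \<open>simp add: B_def\<close>)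
    also have "\<dots> = (\<Sum>g\<in>carrier G. (m * N\<^sup>2) *\<^sub>R (cnj (\<Gamma> g $ k $ i) * \<Gamma> g $ k $ j))"
      by (intro sum.cong refl) (simp add: Bm power2_eq_square)
    also have "\<dots> = (m * N\<^sup>2) *\<^sub>R (if i = j then of_real c else 0)"
      by (simp only: scaleR_sum_right[symmetric] orth)
    also have "\<dots> = (if i = j then 1 else 0)"
      using arg_cong[OF N, of complex_of_real] by (simp add: scaleR_conv_of_real)
    finally show ?thesis .
  qed
  moreover have "I (matrix_inv (R h) *v x) = transpose (\<Gamma> h) *v I x" if h: "h \<in> carrier G" for h x
  proof -
    have mem: "R (inv h) *v x \<in> B (g \<otimes> h) \<longleftrightarrow> x \<in> B g" if g: "g \<in> carrier G" for g
    proof -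
      have "B (g \<otimes> h) = (*v) (R (inv h)) ` B g"
        using g h by (simp add: B_def inv_mult_group R(4,5) spherical_cap_orthogonal_image
            flip: matrix_vector_mul_assoc)
      moreover have "inj ((*v) (R (inv h)))"
        using R(4)[of "inv h"] h
        by (intro inj_matrix_vector_mult) (auto simp: orthogonal_matrix_def invertible_def)
      ultimately show ?thesis by (simp add: inj_image_mem_iff)
    qed
    have "I (R (inv h) *v x) $ i = (transpose (\<Gamma> h) *v I x) $ i" for i
    proof -
      have "I (R (inv h) *v x) $ i =
          (\<Sum>g\<in>carrier G. indicator (B (g \<otimes> h)) (R (inv h) *v x) *\<^sub>R (N *\<^sub>R \<Gamma> (g \<otimes> h) $ k $ i))"
        unfolding I_def vec_lambda_beta
        by (rule sum.reindex_bij_witness[of _ "\<lambda>g. g \<otimes> h" "\<lambda>g. g \<otimes> inv h"])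
           (auto simp: h m_assoc)
      also have "\<dots> = (\<Sum>g\<in>carrier G. \<Sum>l\<in>UNIV. \<Gamma> h $ l $ i * indicator (B g) x *\<^sub>R (N *\<^sub>R \<Gamma> g $ k $ l))"
        using h
        by (intro sum.cong refl)
           (simp add: mem indicator_def unitary_rep_D(3)[OF rep] matrix_matrix_mult_def
              scaleR_sum_right mult.commute)
      also have "\<dots> = (\<Sum>l\<in>UNIV. \<Gamma> h $ l $ i * I x $ l)"
        by (subst sum.swap) (simp add: I_def sum_distrib_left)
      also have "\<dots> = (transpose (\<Gamma> h) *v I x) $ i"
        by (simp add: matrix_vector_mult_def transpose_def del: transpose_matrix_vector)
      finally show ?thesis .
    qed
    then show ?thesis by (simp only: vec_eq_iff R(7)[OF h]) simp
  qed
  ultimately have "basis_function G R \<Gamma>\<^sub>c I"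
    unfolding basis_function_def using rep equiv by blast
  moreover have "I x $ i \<in> \<real>" for x i
    unfolding I_def vec_lambda_beta
    by (intro sum_in_Reals)
       (use real in \<open>auto simp: real_matrix_def scaleR_conv_of_real\<close>)
  ultimately show ?thesis
    by (auto simp: real_basis_function_def)
qed

text \<open>
  The left-hand side of the equivariance equation is real, so the combination of the real
  components of \<open>I\<close> with the imaginary parts of a column of \<open>\<Gamma> g\<close> vanishes on the sphere;
  linear independence kills these imaginary parts.
\<close>

lemma real_basis_function_imp_real_rep:
  fixes G :: "('g, 'b) monoid_scheme" (structure) and \<Gamma>\<^sub>c :: "'g \<Rightarrow> complex^'d^'d"
  assumes poly: "polyhedral_group G R" and I: "real_basis_function G R \<Gamma>\<^sub>c I"
  obtains \<Gamma> where "unitary_rep G \<Gamma>" "equivalent_reps G \<Gamma>\<^sub>c \<Gamma>"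
    "\<And>g. g \<in> carrier G \<Longrightarrow> real_matrix (\<Gamma> g)"
proof -
  note R = polyhedral_groupD[OF poly]
  interpret group G by (rule R(1))
  obtain \<Gamma> where \<Gamma>: "unitary_rep G \<Gamma>" "equivalent_reps G \<Gamma>\<^sub>c \<Gamma>"
    and equivar: "\<And>g x. g \<in> carrier G \<Longrightarrow> x \<in> sphere 0 1 \<Longrightarrow>
        I (matrix_inv (R g) *v x) = transpose (\<Gamma> g) *v I x"
    and sq: "\<And>i. square_integrable sphere_measure (\<lambda>x. I x $ i)"
    and on: "\<And>i j. L2_inner sphere_measure (\<lambda>x. I x $ i) (\<lambda>x. I x $ j) = (if i = j then 1 else 0)"
    using I unfolding real_basis_function_def basis_function_def by blast
  have real: "Im (I x $ i) = 0" if "x \<in> sphere 0 1" for x i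
    using I that by (auto simp: real_basis_function_def complex_is_Real_iff)
  have "Im (\<Gamma> g $ k $ i) = 0" if g: "g \<in> carrier G" for g k i
  proof -
    have "complex_of_real (Im (\<Gamma> g $ k $ i)) = 0"
    proof (rule orthonormal_independent[OF sq on, where c = "\<lambda>j. complex_of_real (Im (\<Gamma> g $ j $ i))"])
      fix x :: "real^3" assume "x \<in> space sphere_measure"
      then have x: "x \<in> sphere 0 1" by simp
      have "R (inv g) *v x \<in> sphere 0 1"
        using x orthogonal_matrix_norm[OF R(4)[of "inv g"], of x] g by simp
      then have "Im (I (R (inv g) *v x) $ i) = 0" by (rule real)
      also have "I (R (inv g) *v x) $ i = (\<Sum>j\<in>UNIV. \<Gamma> g $ j $ i * I x $ j)"
        using equivar[OF g x] g
        by (simp add: R(7) matrix_vector_mult_def transpose_def del: transpose_matrix_vector)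
      finally have "(\<Sum>j\<in>UNIV. Im (\<Gamma> g $ j $ i) * Re (I x $ j)) = 0"
        by (simp add: real[OF x])
      then show "(\<Sum>j\<in>UNIV. complex_of_real (Im (\<Gamma> g $ j $ i)) * I x $ j) = 0"
        by (simp add: complex_eq_iff real[OF x])
    qed
    then show ?thesis by simp
  qed
  then have "real_matrix (\<Gamma> g)" if "g \<in> carrier G" for g
    using that by (auto simp: real_matrix_def complex_is_Real_iff)
  with \<Gamma> that show thesis by blast
qed

theorem proposition2:
  fixes G :: "('g, 'b) monoid_scheme"
    and R :: "'g \<Rightarrow> real^3^3"
    and \<Gamma>\<^sub>c :: "'g \<Rightarrow> complex^'d^'d"
  assumes "polyhedral_group G R"
    and "unitary_rep G \<Gamma>\<^sub>c"
    and "irreducible_rep G \<Gamma>\<^sub>c"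
  shows "(\<exists>I. real_basis_function G R \<Gamma>\<^sub>c I) \<longleftrightarrow> potentially_real G \<Gamma>\<^sub>c"
proof
  assume "\<exists>I. real_basis_function G R \<Gamma>\<^sub>c I"
  then obtain \<Gamma> where \<Gamma>: "unitary_rep G \<Gamma>" "equivalent_reps G \<Gamma>\<^sub>c \<Gamma>"
    "\<And>g. g \<in> carrier G \<Longrightarrow> real_matrix (\<Gamma> g)"
    using real_basis_function_imp_real_rep[OF assms(1)] by metis
  obtain S where "unitary_matrix S" "\<And>g. g \<in> carrier G \<Longrightarrow> \<Gamma> g = conj_transpose S ** \<Gamma>\<^sub>c g ** S"
    by (rule unitarily_equivalent[OF assms(2,3) \<Gamma>(1,2)]) blast
  with \<Gamma>(3) show "potentially_real G \<Gamma>\<^sub>c"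
    unfolding potentially_real_def by metis
next
  assume "potentially_real G \<Gamma>\<^sub>c"
  then obtain S where S: "unitary_matrix S"
    "\<And>g. g \<in> carrier G \<Longrightarrow> real_matrix (conj_transpose S ** \<Gamma>\<^sub>c g ** S)"
    by (auto simp: potentially_real_def)
  have "conj_transpose S = matrix_inv S" "invertible S"
    using S(1) matrix_inv_eqI[of "conj_transpose S" S]
    by (auto simp: unitary_matrix_def invertible_def)
  then have "equivalent_reps G \<Gamma>\<^sub>c (\<lambda>g. conj_transpose S ** \<Gamma>\<^sub>c g ** S)"
    by (auto simp: equivalent_reps_def)
  with S show "\<exists>I. real_basis_function G R \<Gamma>\<^sub>c I"
    by (intro real_basis_function_exists[OF assms(1) unitary_rep_conj[OF assms(2)]
          irreducible_rep_conj[OF assms(3)]])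
qed

end
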